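(* For any integer $k\ge 3$ and constant $\gamma>0$, there is an integer $n_0$ such that the following holds. Let $n\ge n_0$ be an integer not divisible by $k$ and let $H$ be an $n$-vertex $k$-uniform hypergraph with $\delta_{k-1}(H)\ge \frac{n}{k}-\gamma n$. If $H$ is not $5k\gamma$-extremal, then $H$ contains a matching of size $\lfloor n/k\rfloor$ (a near perfect matching).
   Context: A $k$-uniform hypergraph $H$ has vertex set $V(H)$ and edge set $E(H)\subseteq\binom{V(H)}{k}$. A matching is a collection of pairwise vertex-disjoint edges; when $k\nmid |V(H)|$, a near perfect matching is a matching of size $\lfloor |V(H)|/k\rfloor$. $\delta_{k-1}(H)$ is the minimum, over all $(k-1)$-sets $S$ of vertices, of the number of edges containing $S$. A set of vertices is independent if it contains no edge of $H$. For $\beta>0$, an $n$-vertex $k$-graph $H$ is $\beta$-extremal if $V(H)$ contains an independent set of size at least $(1-\beta)\frac{k-1}{k}n$. *)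

theory Defs
  imports Complex_Main "HOL-Library.Ramsey" "HOL-Library.Disjoint_Sets"
begin

definition uniform_hypergraph :: "nat \<Rightarrow> 'a set \<Rightarrow> 'a set set \<Rightarrow> bool" where
  "uniform_hypergraph k V E \<longleftrightarrow> finite V \<and> E \<subseteq> nsets V k"

definition hyperdegree :: "'a set set \<Rightarrow> 'a set \<Rightarrow> nat" where
  "hyperdegree E S = card {e \<in> E. S \<subseteq> e}"

(* min_degree d V E is \<delta>\<^sub>d. It is only meaningful for d \<le> card V; otherwise
   there are no d-subsets of V and the minimum is unspecified. *)
definition min_degree :: "nat \<Rightarrow> 'a set \<Rightarrow> 'a set set \<Rightarrow> nat" where
  "min_degree d V E = Min (hyperdegree E ` nsets V d)"

definition matching :: "'a set set \<Rightarrow> 'a set set \<Rightarrow> bool" where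
  "matching E M \<longleftrightarrow> M \<subseteq> E \<and> disjoint M"

definition independent_vertices :: "'a set \<Rightarrow> 'a set set \<Rightarrow> 'a set \<Rightarrow> bool" where
  "independent_vertices V E S \<longleftrightarrow> S \<subseteq> V \<and> (\<forall>e\<in>E. \<not> e \<subseteq> S)"

definition extremal :: "real \<Rightarrow> nat \<Rightarrow> 'a set \<Rightarrow> 'a set set \<Rightarrow> bool" where
  "extremal \<beta> k V E \<longleftrightarrow>
    (\<exists>S. independent_vertices V E S \<and>
         real (card S) \<ge> (1 - \<beta>) * ((real k - 1) / real k) * real (card V))"

end

theory Submission
  imports Defs "HOL-Real_Asymp.Real_Asymp"
begin

text \<open>Absorbing method.  An edge \<open>e\<close> absorbs a disjoint set \<open>S\<close> of \<open>k + 1\<close> vertices if two disjoint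
  edges lie in \<open>S \<union> e\<close>; exchanging \<open>e\<close> for them covers \<open>k\<close> more vertices.  A positive fraction
  of all \<open>k\<close>-tuples absorbs a given \<open>S\<close>, so a greedy choice yields, for every constant \<open>r\<close>, a
  matching \<open>M\<^sub>a\<close> covering at most \<open>\<gamma>n\<close> vertices that contains \<open>r\<close> absorbers of every \<open>S\<close>.  A maximum
  matching avoiding \<open>M\<^sub>a\<close> leaves fewer than \<open>r\<close> vertices uncovered: otherwise an exchange
  argument produces an independent set that makes the hypergraph extremal.  The leftover is then
  absorbed, \<open>k\<close> vertices at a time, until at most \<open>k\<close> remain; as \<open>k\<close> does not divide \<open>n\<close>, fewer than
  \<open>k\<close> remain.\<close>

section \<open>Selecting representatives and disjoint subsets\<close>

lemma ex_distinct_representatives: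
  assumes "finite X" "\<And>x. x \<in> X \<Longrightarrow> finite (N x) \<and> card X \<le> card (N x)"
  shows "\<exists>f. inj_on f X \<and> (\<forall>x\<in>X. f x \<in> N x)"
proof -
  have "\<exists>f. inj_on f Y \<and> (\<forall>x\<in>Y. f x \<in> N x)" if "Y \<subseteq> X" for Y
    using finite_subset[OF that assms(1)] that
  proof (induction Y rule: finite_induct)
    case empty
    then show ?case by simp
  next
    case (insert y Y)
    then obtain f where f: "inj_on f Y" "\<forall>x\<in>Y. f x \<in> N x" by auto
    have "card (f ` Y) \<le> card Y" by (rule card_image_le[OF insert.hyps(1)])
    also have "\<dots> < card (insert y Y)" using insert.hyps by simp
    also have "\<dots> \<le> card X" by (rule card_mono[OF assms(1) insert.prems])
    also have "\<dots> \<le> card (N y)" using assms(2) insert.prems by blast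
    finally have "\<not> N y \<subseteq> f ` Y"
      using card_mono[of "f ` Y" "N y"] insert.hyps(1) by auto
    then obtain z where z: "z \<in> N y" "z \<notin> f ` Y" by blast
    have "f(y := z) ` Y = f ` Y" using insert.hyps(2) by (intro image_cong) auto
    then have "inj_on (f(y := z)) (insert y Y)"
      using f(1) z(2) insert.hyps(2) by (auto simp: inj_on_def)
    moreover have "\<forall>x\<in>insert y Y. (f(y := z)) x \<in> N x" using f(2) z(1) by auto
    ultimately show ?case by blast
  qed
  then show ?thesis by blast
qed

lemma ex_disjoint_subsets:
  assumes "finite U" "t * s \<le> card U"
  shows "\<exists>A :: nat \<Rightarrow> 'a set. (\<forall>i<t. A i \<subseteq> U \<and> card (A i) = s) \<and> disjoint_family_on A {..<t}"
  using assms
proof (induction t arbitrary: U)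
  case 0
  then show ?case by (auto simp: disjoint_family_on_def)
next
  case (Suc t)
  then obtain B where B: "B \<subseteq> U" "card B = s"
    by (metis add_leD1 mult_Suc obtain_subset_with_card_n)
  have fB: "finite B" using B(1) Suc.prems(1) finite_subset by blast
  have "t * s \<le> card (U - B)" using Suc.prems B fB by (simp add: card_Diff_subset)
  from Suc.IH[OF _ this] Suc.prems obtain A where
    A: "\<And>i. i < t \<Longrightarrow> A i \<subseteq> U - B \<and> card (A i) = s" "disjoint_family_on A {..<t}"
    by blast
  have "\<forall>i<Suc t. (A(t := B)) i \<subseteq> U \<and> card ((A(t := B)) i) = s"
    using A(1) B by (auto simp: less_Suc_eq)
  moreover have "disjoint_family_on (A(t := B)) {..<Suc t}"
    using A B unfolding disjoint_family_on_def lessThan_Suc by auto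
  ultimately show ?case by blast
qed

section \<open>Counting lists whose entries are chosen one after another\<close>

primrec branch :: "('a list \<Rightarrow> 'a set) \<Rightarrow> 'a list \<Rightarrow> bool" where
  "branch N [] \<longleftrightarrow> True"
| "branch N (x # xs) \<longleftrightarrow> x \<in> N xs \<and> branch N xs"

text \<open>A list in \<open>branch N\<close> grows at its head, each new entry coming from a set
  that depends on the tail. Every such list of length below \<open>l\<close> extends in at least
  \<open>m\<close> ways, so their number is multiplied by at least \<open>m\<close> per
  entry.\<close>

lemma card_branch_ge:
  assumes "\<And>xs. length xs < l \<Longrightarrow> branch N xs \<Longrightarrow> finite (N xs) \<and> m \<le> card (N xs)"
  shows "finite {xs. length xs = l \<and> branch N xs} \<and>
    m ^ l \<le> card {xs. length xs = l \<and> branch N xs}"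
  using assms
proof (induction l)
  case 0
  have "{xs. length xs = 0 \<and> branch N xs} = {[]}" by auto
  then show ?case by simp
next
  case (Suc l)
  define L where "L = {xs. length xs = l \<and> branch N xs}"
  have IH: "finite L" "m ^ l \<le> card L" using Suc by (auto simp: L_def)
  have N: "finite (N xs)" "m \<le> card (N xs)" if "xs \<in> L" for xs
    using that Suc.prems[of xs] by (auto simp: L_def)
  have eq: "{xs. length xs = Suc l \<and> branch N xs} = (\<lambda>(xs, x). x # xs) ` (SIGMA xs:L. N xs)"
    by (auto simp: L_def length_Suc_conv image_iff)
  have "m ^ Suc l \<le> card L * m" using IH(2) by simp
  also have "\<dots> = (\<Sum>xs\<in>L. m)" by simp
  also have "\<dots> \<le> (\<Sum>xs\<in>L. card (N xs))" by (intro sum_mono N)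
  also have "\<dots> = card (SIGMA xs:L. N xs)" using IH(1) N by simp
  also have "\<dots> = card {xs. length xs = Suc l \<and> branch N xs}"
    unfolding eq by (rule card_image[symmetric]) (auto simp: inj_on_def)
  finally show ?case unfolding eq using IH(1) N by auto
qed

section \<open>Uniform hypergraphs and matchings\<close>

lemma matching_Un:
  assumes "matching E M1" "matching E M2" "\<Union>M1 \<inter> \<Union>M2 = {}"
  shows "matching E (M1 \<union> M2)"
proof -
  have "a \<inter> b = {}" "b \<inter> a = {}" if "a \<in> M1" "b \<in> M2" for a b
    using assms(3) that by blast+
  then show ?thesis
    using assms(1,2) by (simp add: matching_def pairwise_def disjnt_def ball_Un)
qed

lemma matching_subset: "matching E M \<Longrightarrow> R \<subseteq> M \<Longrightarrow> matching E R"
  unfolding matching_def by (meson pairwise_subset subset_trans)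

lemma matching_Union_Diff:
  assumes "matching E M" "R \<subseteq> M"
  shows "\<Union>(M - R) \<inter> \<Union>R = {}"
proof -
  have "a \<inter> b = {}" if "a \<in> M - R" "b \<in> R" for a b
  proof -
    have "a \<in> M" "b \<in> M" "a \<noteq> b" using that assms(2) by auto
    then show ?thesis using assms(1) by (simp add: matching_def pairwise_def disjnt_def)
  qed
  then show ?thesis by blast
qed

locale kgraph =
  fixes k :: nat and V :: "'a set" and E :: "'a set set"
  assumes k_ge_2: "k \<ge> 2"
    and uniform: "uniform_hypergraph k V E"
begin

lemma finite_V: "finite V"
  using uniform by (simp add: uniform_hypergraph_def)

lemma edgeD: "e \<in> E \<Longrightarrow> e \<subseteq> V" "e \<in> E \<Longrightarrow> finite e" "e \<in> E \<Longrightarrow> card e = k"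
  using uniform by (auto simp: uniform_hypergraph_def nsets_def)

lemma edge_nonempty: "e \<in> E \<Longrightarrow> e \<noteq> {}"
  using edgeD(3)[of e] k_ge_2 by auto

lemma finite_E: "finite E"
  by (rule finite_subset[of _ "Pow V"]) (use edgeD(1) finite_V in auto)

lemma matchingD:
  assumes "matching E M"
  shows "M \<subseteq> E" "finite M" "\<Union>M \<subseteq> V" "finite (\<Union>M)" "card (\<Union>M) = k * card M"
proof -
  show M: "M \<subseteq> E" using assms by (simp add: matching_def)
  then show "finite M" using finite_E finite_subset by blast
  show "\<Union>M \<subseteq> V" using M edgeD(1) by blast
  then show "finite (\<Union>M)" using finite_V finite_subset by blast
  have "card (\<Union>M) = sum card M"
    using assms M edgeD(2) by (intro card_Union_disjoint) (auto simp: matching_def)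
  also have "\<dots> = (\<Sum>e\<in>M. k)" using M edgeD(3) by (intro sum.cong) auto
  finally show "card (\<Union>M) = k * card M" by simp
qed

text \<open>Disjoint vertex sets force disjoint families because edges are nonempty: a common edge
  would contain common vertices.\<close>

lemma card_matching_Un:
  assumes "matching E M1" "matching E M2" "\<Union>M1 \<inter> \<Union>M2 = {}"
  shows "card (M1 \<union> M2) = card M1 + card M2"
proof (rule card_Un_disjoint)
  show "M1 \<inter> M2 = {}"
    using assms(3) edge_nonempty matchingD(1)[OF assms(1)] by blast
qed (use assms matchingD(2) in auto)

lemma card_matching_Int:
  assumes "matching E M" "finite X"
  shows "card (\<Union>M \<inter> X) = (\<Sum>e\<in>M. card (e \<inter> X))"
proof -
  have disj: "e \<inter> e' = {}" if "e \<in> M" "e' \<in> M" "e \<noteq> e'" for e e'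
    using assms(1) that by (auto simp: matching_def pairwise_def disjnt_def)
  have "card (\<Union>e\<in>M. e \<inter> X) = (\<Sum>e\<in>M. card (e \<inter> X))"
  proof (rule card_UN_disjoint[OF matchingD(2)[OF assms(1)]])
    show "\<forall>e\<in>M. \<forall>e'\<in>M. e \<noteq> e' \<longrightarrow> (e \<inter> X) \<inter> (e' \<inter> X) = {}"
      using disj by blast
  qed (use assms(2) in auto)
  moreover have "(\<Union>e\<in>M. e \<inter> X) = \<Union>M \<inter> X" by blast
  ultimately show ?thesis by simp
qed

section \<open>Neighbourhoods of (k-1)-sets and the minimum codegree\<close>

definition nbh :: "'a set \<Rightarrow> 'a set" where
  "nbh A = {v \<in> V. v \<notin> A \<and> insert v A \<in> E}"

lemma nbh_subset: "nbh A \<subseteq> V"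
  by (auto simp: nbh_def)

lemma finite_nbh: "finite (nbh A)"
  using finite_subset[OF nbh_subset finite_V] .

text \<open>The map \<open>v \<mapsto> insert v A\<close> is a bijection from \<open>nbh A\<close>
  onto the edges containing \<open>A\<close>: such an edge has exactly one vertex outside
  \<open>A\<close>, and the condition \<open>v \<notin> A\<close> in \<open>nbh\<close> gives
  injectivity.\<close>

lemma card_nbh:
  assumes "A \<in> nsets V (k - 1)"
  shows "card (nbh A) = hyperdegree E A"
proof -
  have A: "A \<subseteq> V" "finite A" "card A = k - 1" using assms by (auto simp: nsets_def)
  have "e \<in> (\<lambda>v. insert v A) ` nbh A" if e: "e \<in> E" "A \<subseteq> e" for e
  proof -
    have "card (e - A) = 1"
      using e A edgeD[of e] k_ge_2 by (simp add: card_Diff_subset)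
    then obtain v where v: "e - A = {v}" by (auto simp: card_1_singleton_iff)
    then have "e = insert v A" using e by auto
    then show ?thesis using e v edgeD(1)[OF e(1)] by (auto simp: nbh_def)
  qed
  then have "(\<lambda>v. insert v A) ` nbh A = {e \<in> E. A \<subseteq> e}"
    by (auto simp: nbh_def)
  moreover have "inj_on (\<lambda>v. insert v A) (nbh A)"
    by (auto simp: inj_on_def nbh_def)
  ultimately show ?thesis unfolding hyperdegree_def by (metis card_image)
qed

lemma min_degree_le_card_nbh:
  assumes "A \<in> nsets V (k - 1)"
  shows "min_degree (k - 1) V E \<le> card (nbh A)"
  unfolding min_degree_def card_nbh[OF assms]
  using assms finite_V by (intro Min_le finite_imageI finite_imp_finite_nsets imageI)

lemma ex_maximum_matching:
  "\<exists>M. matching E M \<and> \<Union>M \<inter> W = {} \<and>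
    (\<forall>M'. matching E M' \<longrightarrow> \<Union>M' \<inter> W = {} \<longrightarrow> card M' \<le> card M)"
proof -
  have "\<exists>M. (matching E M \<and> \<Union>M \<inter> W = {}) \<and>
    (\<forall>M'. matching E M' \<and> \<Union>M' \<inter> W = {} \<longrightarrow> card M' \<le> card M)"
    by (rule ex_has_greatest_nat[where b = "Suc (card E)" and k = "{}"])
      (auto simp: matching_def less_Suc_eq_le intro: card_mono[OF finite_E])
  then show ?thesis by blast
qed

section \<open>Almost perfect matchings\<close>

text \<open>The edges of \<open>R\<close> are exchanged for \<open>M0\<close> and one new edge
  through each \<open>x\<close> in \<open>X\<close>, made of \<open>x\<close> and some
  \<open>A i\<close> outside the matching. By \<open>deg\<close> the indices can be chosen distinct,
  so the new edges are disjoint. The lemma serves to contradict maximality when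
  \<open>card R < card M0 + card X\<close>.\<close>

lemma augment:
  fixes A :: "'i \<Rightarrow> 'a set"
  assumes M: "matching E M" and R: "R \<subseteq> M" and X: "X \<subseteq> \<Union>R"
    and M0: "matching E M0" "\<Union>M0 \<subseteq> \<Union>R - X"
    and A: "\<And>i. i \<in> I \<Longrightarrow> A i \<inter> \<Union>M = {}" "disjoint_family_on A I" "finite I"
    and deg: "\<And>x. x \<in> X \<Longrightarrow> card X \<le> card {i \<in> I. x \<in> nbh (A i)}"
  shows "\<exists>M'. matching E M' \<and> card M' + card R = card M + card M0 + card X \<and>
    \<Union>M' \<subseteq> \<Union>M \<union> \<Union>(A ` I)"
proof -
  have finR: "finite R" using R matchingD(2)[OF M] finite_subset by blast
  have XM: "X \<subseteq> \<Union>M" using R X by blast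
  have finX: "finite X" using XM matchingD(4)[OF M] finite_subset by blast
  obtain f where f: "inj_on f X" "\<And>x. x \<in> X \<Longrightarrow> f x \<in> I" "\<And>x. x \<in> X \<Longrightarrow> x \<in> nbh (A (f x))"
    using ex_distinct_representatives[OF finX, of "\<lambda>x. {i \<in> I. x \<in> nbh (A i)}"] A(3) deg by auto
  define st where "st x = insert x (A (f x))" for x
  have stE: "st x \<in> E" if "x \<in> X" for x
    using f(3)[OF that] by (simp add: st_def nbh_def)
  have st_disj: "st x \<inter> st y = {}" if "x \<in> X" "y \<in> X" "x \<noteq> y" for x y
  proof -
    have "f x \<noteq> f y" using that f(1) by (auto dest: inj_onD)
    then have "A (f x) \<inter> A (f y) = {}" using A(2) f(2) that by (auto simp: disjoint_family_on_def)
    moreover have "x \<notin> A (f y)" "y \<notin> A (f x)" using A(1) f(2) XM that by blast+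
    ultimately show ?thesis using that by (auto simp: st_def)
  qed
  have st_inj: "inj_on st X"
    using st_disj stE edge_nonempty by (intro inj_onI) (metis Int_absorb)
  have m1: "matching E (M - R)" using matching_subset[OF M] by blast
  have m2: "matching E (st ` X)"
    using stE st_disj by (auto simp: matching_def pairwise_def disjnt_def)
  have d1: "\<Union>(M - R) \<inter> \<Union>M0 = {}"
    using matching_Union_Diff[OF M R] M0(2) by blast
  have MRX: "\<Union>(M - R) \<inter> X = {}" using matching_Union_Diff[OF M R] X by blast
  have M0R: "\<Union>M0 \<subseteq> \<Union>M" using R M0(2) by blast
  have AM: "A (f x) \<inter> \<Union>M = {}" if "x \<in> X" for x using A(1) f(2) that by blast
  have "st x \<inter> \<Union>(M - R) = {}" "st x \<inter> \<Union>M0 = {}" if "x \<in> X" for x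
    using that AM[OF that] MRX M0R M0(2) unfolding st_def by blast+
  then have d2: "\<Union>(M - R \<union> M0) \<inter> \<Union>(st ` X) = {}" by blast
  define M' where "M' = M - R \<union> M0 \<union> st ` X"
  have m12: "matching E (M - R \<union> M0)" by (rule matching_Un[OF m1 M0(1) d1])
  have "matching E M'" unfolding M'_def by (rule matching_Un[OF m12 m2 d2])
  moreover have "card M' + card R = card M + card M0 + card X"
    unfolding M'_def card_matching_Un[OF m12 m2 d2] card_matching_Un[OF m1 M0(1) d1]
    using card_image[OF st_inj] card_Diff_subset[OF finR R] card_mono[OF matchingD(2)[OF M] R]
    by simp
  moreover have "\<Union>M' \<subseteq> \<Union>M \<union> \<Union>(A ` I)"
    using M0R XM f(2) by (auto simp: M'_def st_def)
  ultimately show ?thesis by blast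
qed

text \<open>Split a large uncovered set into \<open>(k - 1)\<close>-sets and let \<open>D\<close> consist of the covered vertices
  adjacent to at least \<open>k\<close> of them.  By maximality no matching edge contains two vertices of
  \<open>D\<close>, and no edge lies in the union of the matching edges meeting \<open>D\<close> once \<open>D\<close> is removed.\<close>

lemma maximum_matching_independent:
  assumes W: "W \<subseteq> V"
    and M: "matching E M" "\<Union>M \<inter> W = {}"
    and max: "\<And>M'. matching E M' \<Longrightarrow> \<Union>M' \<inter> W = {} \<Longrightarrow> card M' \<le> card M"
    and deg: "\<And>A. A \<in> nsets V (k - 1) \<Longrightarrow> d \<le> card (nbh A)"
    and large: "t * (k - 1) \<le> card (V - W - \<Union>M)"
  shows "\<exists>T. independent_vertices V E T \<and>
    (k - 1) * (t * d) \<le> t * card T + (k - 1) * (t * card W + k * card V)"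
proof -
  define U where "U = V - W - \<Union>M"
  have finU: "finite U" using finite_V by (simp add: U_def)
  obtain A :: "nat \<Rightarrow> 'a set" where
    A: "\<And>i. i < t \<Longrightarrow> A i \<subseteq> U" "\<And>i. i < t \<Longrightarrow> card (A i) = k - 1" "disjoint_family_on A {..<t}"
    using ex_disjoint_subsets[OF finU large[folded U_def]] by auto
  have A_nsets: "A i \<in> nsets V (k - 1)" if "i < t" for i
    using A(1,2)[OF that] finU finite_subset[of "A i" U] by (auto simp: nsets_def U_def)
  have A_M: "A i \<inter> \<Union>M = {}" if "i < t" for i using A(1)[OF that] by (auto simp: U_def)
  have AU: "\<Union>(A ` {..<t}) \<inter> W = {}" using A(1) by (auto simp: U_def)
  \<comment> \<open>Every exchange that gains an edge is excluded: the vertices it newly uses lie in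
    \<open>U\<close>, hence outside \<open>W\<close>, so \<open>max\<close> applies.\<close>
  have contra: False if prems: "R \<subseteq> M" "X \<subseteq> \<Union>R" "matching E M0" "\<Union>M0 \<subseteq> \<Union>R - X"
    "\<And>x. x \<in> X \<Longrightarrow> card X \<le> card {i \<in> {..<t}. x \<in> nbh (A i)}" "card R < card M0 + card X" for R X M0
  proof -
    obtain M' where M': "matching E M'" "card M' + card R = card M + card M0 + card X"
      "\<Union>M' \<subseteq> \<Union>M \<union> \<Union>(A ` {..<t})"
      using augment[OF M(1) prems(1-4) _ A(3) _ prems(5)] A_M by auto
    have "\<Union>M' \<inter> W = {}" using M'(3) M(2) AU by blast
    from max[OF M'(1) this] M'(2) prems(6) show False by simp
  qed
  \<comment> \<open>A neighbour in \<open>U\<close> would complete \<open>A i\<close> to an edge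
    that enlarges \<open>M\<close>.\<close>
  have nbh_sub: "nbh (A i) \<subseteq> W \<union> \<Union>M" if i: "i < t" for i
  proof
    fix v assume v: "v \<in> nbh (A i)"
    show "v \<in> W \<union> \<Union>M"
    proof (rule ccontr)
      assume "v \<notin> W \<union> \<Union>M"
      then have sub: "insert v (A i) \<subseteq> U" using v A(1)[OF i] nbh_subset by (auto simp: U_def)
      have m: "matching E {insert v (A i)}" using v by (auto simp: matching_def nbh_def)
      have d: "\<Union>M \<inter> \<Union>{insert v (A i)} = {}" using sub by (auto simp: U_def)
      have "\<Union>(M \<union> {insert v (A i)}) \<inter> W = {}" using M(2) sub by (auto simp: U_def)
      from max[OF matching_Un[OF M(1) m d] this]
      show False unfolding card_matching_Un[OF M(1) m d] by simp
    qed
  qed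
  define dg where "dg v = card {i \<in> {..<t}. v \<in> nbh (A i)}" for v
  \<comment> \<open>The threshold \<open>k\<close> suffices because no exchange below uses more than
    \<open>k\<close> vertices of \<open>D\<close>: two in \<open>D_le\<close>, and one for each of
    at most \<open>k\<close> matching edges in the independence of \<open>T\<close>.\<close>
  define D where "D = {v \<in> \<Union>M. k \<le> dg v}"
  have finD: "finite D" using matchingD(4)[OF M(1)] by (rule finite_subset[rotated]) (auto simp: D_def)
  have D_le: "card (e \<inter> D) \<le> 1" if e: "e \<in> M" for e
  proof (rule ccontr)
    assume "\<not> card (e \<inter> D) \<le> 1"
    then obtain X where X: "X \<subseteq> e \<inter> D" "card X = 2" "finite X"
      by (metis not_less_eq_eq obtain_subset_with_card_n numeral_2_eq_2 One_nat_def)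
    show False
    proof (rule contra[of "{e}" X "{}"])
      show "matching E {}" by (simp add: matching_def)
      show "card X \<le> card {i \<in> {..<t}. x \<in> nbh (A i)}" if "x \<in> X" for x
      proof -
        have "k \<le> dg x" using that X(1) by (auto simp: D_def)
        then show ?thesis using X(2) k_ge_2 by (simp add: dg_def)
      qed
    qed (use e X in auto)
  qed
  define MD where "MD = {e \<in> M. e \<inter> D \<noteq> {}}"
  have MD_M: "MD \<subseteq> M" by (auto simp: MD_def)
  have card_D: "card (\<Union>R \<inter> D) = card R" if R: "R \<subseteq> MD" for R
  proof -
    have "card (\<Union>R \<inter> D) = (\<Sum>e\<in>R. card (e \<inter> D))"
      using R MD_M by (intro card_matching_Int[OF matching_subset[OF M(1)] finD]) blast
    also have "\<dots> = (\<Sum>e\<in>R. 1)"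
    proof (rule sum.cong[OF refl])
      fix e assume "e \<in> R"
      then have "e \<in> M" "e \<inter> D \<noteq> {}" using R by (auto simp: MD_def)
      then show "card (e \<inter> D) = 1"
        using D_le[of e] finD by (metis card_gt_0_iff finite_Int le_antisym One_nat_def Suc_leI)
    qed
    finally show ?thesis by simp
  qed
  \<comment> \<open>Each edge of \<open>MD\<close> has exactly one vertex in \<open>D\<close> and
    gives its other \<open>k - 1\<close> vertices to \<open>T\<close>.\<close>
  define T where "T = \<Union>MD - D"
  have "\<Union>MD \<inter> D = D" by (auto simp: MD_def D_def)
  with card_D[of MD] have cMD: "card MD = card D" "D \<subseteq> \<Union>MD" by auto
  have cT: "card T = (k - 1) * card D"
    unfolding T_def using card_Diff_subset[OF finD cMD(2)] cMD(1)
      matchingD(5)[OF matching_subset[OF M(1) MD_M]]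
    by (simp add: diff_mult_distrib)
  have "independent_vertices V E T"
    unfolding independent_vertices_def
  proof (intro conjI ballI notI)
    show "T \<subseteq> V" using MD_M matchingD(3)[OF M(1)] by (auto simp: T_def)
    fix e0 assume e0: "e0 \<in> E" "e0 \<subseteq> T"
    \<comment> \<open>An edge \<open>e0\<close> inside \<open>T\<close> meets at most
      \<open>k\<close> edges of \<open>M\<close>, all of them in \<open>MD\<close>. Exchanging these
      for \<open>e0\<close> and one new edge through each of their vertices in \<open>D\<close>
      gains one edge.\<close>
    define R where "R = {e \<in> M. e \<inter> e0 \<noteq> {}}"
    have RM: "R \<subseteq> M" by (auto simp: R_def)
    have R_MD: "R \<subseteq> MD"
    proof
      fix e assume e: "e \<in> R"
      then obtain x where x: "x \<in> e" "x \<in> e0" by (auto simp: R_def)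
      then obtain e' where e': "e' \<in> MD" "x \<in> e'" using e0 by (auto simp: T_def)
      have "e = e'"
        using M(1) e e' x RM MD_M unfolding matching_def pairwise_def disjnt_def by blast
      then show "e \<in> MD" using e' by simp
    qed
    have "card R = (\<Sum>e\<in>R. 1)" by simp
    also have "\<dots> \<le> (\<Sum>e\<in>R. card (e \<inter> e0))"
      using edgeD(2)[OF e0(1)] by (intro sum_mono) (auto simp: R_def Suc_le_eq card_gt_0_iff)
    also have "\<dots> = card (\<Union>R \<inter> e0)"
      by (rule card_matching_Int[OF matching_subset[OF M(1) RM] edgeD(2)[OF e0(1)], symmetric])
    also have "\<dots> \<le> card e0" by (rule card_mono[OF edgeD(2)[OF e0(1)]]) auto
    finally have Rk: "card R \<le> k" using edgeD(3)[OF e0(1)] by simp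
    show False
    proof (rule contra[of R "\<Union>R \<inter> D" "{e0}"])
      show "matching E {e0}" using e0 by (auto simp: matching_def)
      show "\<Union>{e0} \<subseteq> \<Union>R - \<Union>R \<inter> D"
        using e0(2) MD_M unfolding T_def R_def by blast
      show "card (\<Union>R \<inter> D) \<le> card {i \<in> {..<t}. x \<in> nbh (A i)}" if "x \<in> \<Union>R \<inter> D" for x
        using that Rk card_D[OF R_MD] by (auto simp: D_def dg_def)
      show "card R < card {e0} + card (\<Union>R \<inter> D)" using card_D[OF R_MD] by simp
    qed (use RM in auto)
  qed
  moreover have "(k - 1) * (t * d) \<le> t * card T + (k - 1) * (t * card W + k * card V)"
  proof -
    have d_le: "d \<le> card W + card (nbh (A i) \<inter> \<Union>M)" if "i < t" for i
    proof -
      have "d \<le> card (nbh (A i))" by (rule deg[OF A_nsets[OF that]])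
      also have "\<dots> \<le> card (W \<union> (nbh (A i) \<inter> \<Union>M))"
        using nbh_sub[OF that] finite_subset[OF W finite_V] finite_nbh by (intro card_mono) auto
      also have "\<dots> \<le> card W + card (nbh (A i) \<inter> \<Union>M)" by (rule card_Un_le)
      finally show ?thesis .
    qed
    \<comment> \<open>Double count of the pairs of an index \<open>i\<close> and a covered neighbour
      \<open>v\<close> of \<open>A i\<close>: a vertex of \<open>D\<close> lies in at most
      \<open>t\<close> pairs, any other covered vertex in fewer than \<open>k\<close>. The factor
      \<open>k - 1\<close> then turns \<open>card D\<close> into \<open>card T\<close>.\<close>
    have "t * d = (\<Sum>i<t. d)" by simp
    also have "\<dots> \<le> (\<Sum>i<t. card W + card (nbh (A i) \<inter> \<Union>M))" by (intro sum_mono d_le) simp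
    also have "\<dots> = t * card W + (\<Sum>i<t. card (nbh (A i) \<inter> \<Union>M))" by (simp add: sum.distrib)
    also have "(\<Sum>i<t. card (nbh (A i) \<inter> \<Union>M)) = (\<Sum>i<t. card {v \<in> \<Union>M. v \<in> nbh (A i)})"
      by (intro sum.cong refl arg_cong[where f = card]) auto
    also have "\<dots> = (\<Sum>v\<in>\<Union>M. dg v)"
      unfolding dg_def
      using sum_multicount_gen[of "{..<t}" "\<Union>M" "\<lambda>i v. v \<in> nbh (A i)" dg] matchingD(4)[OF M(1)]
      by (auto simp: dg_def)
    also have "\<dots> \<le> (\<Sum>v\<in>\<Union>M. (if v \<in> D then t else 0) + k)"
    proof (rule sum_mono)
      fix v assume "v \<in> \<Union>M"
      moreover have "dg v \<le> t" unfolding dg_def using card_mono[of "{..<t}" "{i \<in> {..<t}. v \<in> nbh (A i)}"] by auto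
      ultimately show "dg v \<le> (if v \<in> D then t else 0) + k" by (auto simp: D_def)
    qed
    also have "\<dots> = t * card D + k * card (\<Union>M)"
      using matchingD(4)[OF M(1)]
      by (simp add: sum.distrib sum.If_cases D_def Int_def conj_commute)
    also have "\<dots> \<le> t * card D + k * card V"
      using card_mono[OF finite_V matchingD(3)[OF M(1)]] by simp
    finally have "t * d \<le> t * card W + (t * card D + k * card V)" by simp
    then have "(k - 1) * (t * d) \<le> (k - 1) * (t * card W + (t * card D + k * card V))"
      by (rule mult_le_mono2)
    then show ?thesis unfolding cT by (simp add: algebra_simps)
  qed
  ultimately show ?thesis by blast
qed

section \<open>Absorbing edges\<close>

text \<open>For \<open>card S = k + 1\<close> the set \<open>S \<union> e\<close> has
  \<open>2 * k + 1\<close> vertices, so \<open>e1\<close> and \<open>e2\<close> miss exactly one of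
  them, which may lie in \<open>e\<close>.\<close>

definition absorbs :: "'a set \<Rightarrow> 'a set \<Rightarrow> bool" where
  "absorbs S e \<longleftrightarrow> e \<in> E \<and> e \<inter> S = {} \<and>
    (\<exists>e1\<in>E. \<exists>e2\<in>E. e1 \<inter> e2 = {} \<and> e1 \<union> e2 \<subseteq> S \<union> e)"

text \<open>Absorbers are counted as lists so that their entries can be chosen one at a time. Each
  entry is taken from a neighbourhood or from \<open>V\<close>, and excluding \<open>S\<close>,
  \<open>W\<close> and the earlier entries leaves at least \<open>m\<close> candidates.\<close>

lemma card_absorbing_lists_ge:
  assumes k3: "k \<ge> 3" and S: "S \<in> nsets V (k + 1)" and W: "W \<subseteq> V"
    and deg: "\<And>A. A \<in> nsets V (k - 1) \<Longrightarrow> m + card W + (2 * k + 1) \<le> card (nbh A)"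
  shows "m ^ k \<le>
    card {xs. length xs = k \<and> set xs \<subseteq> V \<and> set xs \<inter> W = {} \<and> absorbs S (set xs)}"
proof -
  have S': "S \<subseteq> V" "finite S" "card S = k + 1" using S by (auto simp: nsets_def)
  obtain A where A: "A \<subseteq> S" "card A = k - 1"
    using obtain_subset_with_card_n[of "k - 1" S] S'(3) by (metis diff_le_self le_add1 le_trans)
  have finA: "finite A" using A(1) S'(2) finite_subset by blast
  have "card (S - A) = 2" using A S' finA k3 by (simp add: card_Diff_subset)
  then obtain a b where ab: "S - A = {a, b}" "a \<noteq> b" by (auto simp: card_2_iff)
  text \<open>A list is built from its last entry to its first.  The last \<open>k - 2\<close> entries form an edge
    with \<open>a\<close> and \<open>b\<close>, the entry before them forms an edge with \<open>A\<close>, and the whole list is an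
    edge.\<close>
  define C where "C xs =
    (if length xs = k - 3 then nbh ({a, b} \<union> set xs)
     else if length xs = k - 2 then nbh A
     else if length xs = k - 1 then nbh (set xs) else V)" for xs
  define N where "N xs = C xs - (S \<union> W \<union> set xs)" for xs
  have br: "distinct xs \<and> set xs \<subseteq> V - S - W" if "branch N xs" for xs
    using that
  proof (induction xs)
    case (Cons x xs)
    have "C xs \<subseteq> V" using nbh_subset by (auto simp: C_def)
    with Cons show ?case by (auto simp: N_def)
  qed simp
  have N_ge: "finite (N xs) \<and> m \<le> card (N xs)" if xs: "length xs < k" "branch N xs" for xs
  proof -
    note b = br[OF xs(2)]
    have card_xs: "card (set xs) = length xs" using b distinct_card by blast
    have "m + card W + (2 * k + 1) \<le> card (C xs)"
    proof -
      consider "length xs = k - 3" | "length xs = k - 2" | "length xs = k - 1" | "C xs = V"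
        unfolding C_def by presburger
      then show ?thesis
      proof cases
        case 1
        have "{a, b} \<inter> set xs = {}" using ab b by auto
        then have "card ({a, b} \<union> set xs) = k - 1"
          using 1 card_xs ab(2) k3 by (subst card_Un_disjoint) auto
        moreover have "{a, b} \<union> set xs \<subseteq> V" using ab b S'(1) by auto
        ultimately have "{a, b} \<union> set xs \<in> nsets V (k - 1)" by (simp add: nsets_def)
        then show ?thesis using deg 1 by (simp add: C_def)
      next
        case 2
        have "A \<in> nsets V (k - 1)" using A S'(1) finA by (auto simp: nsets_def)
        moreover have "C xs = nbh A"
        proof -
          have "k - 2 \<noteq> k - 3" using k3 by linarith
          then show ?thesis using 2 by (simp add: C_def)
        qed
        ultimately show ?thesis using deg by simp
      next
        case 3
        then have "set xs \<in> nsets V (k - 1)" using card_xs b by (auto simp: nsets_def)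
        moreover have "C xs = nbh (set xs)"
        proof -
          have "k - 1 \<noteq> k - 3" "k - 1 \<noteq> k - 2" using k3 by linarith+
          then show ?thesis using 3 by (simp add: C_def)
        qed
        ultimately show ?thesis using deg by simp
      next
        case 4
        have "A \<in> nsets V (k - 1)" using A S'(1) finA by (auto simp: nsets_def)
        then have "m + card W + (2 * k + 1) \<le> card (nbh A)" by (rule deg)
        then show ?thesis using card_mono[OF finite_V nbh_subset[of A]] 4 by simp
      qed
    qed
    moreover have "card (S \<union> W \<union> set xs) \<le> card W + (2 * k + 1)"
      using card_Un_le[of "S \<union> W" "set xs"] card_Un_le[of S W] S'(3) card_xs xs(1) by simp
    moreover have finSW: "finite (S \<union> W \<union> set xs)" using S'(2) W finite_V finite_subset by auto
    moreover have finC: "finite (C xs)" using finite_nbh finite_V by (auto simp: C_def)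
    ultimately show ?thesis
      using diff_card_le_card_Diff[OF finSW, of "C xs"] by (auto simp: N_def)
  qed
  have "absorbs S (set xs)" if xs: "length xs = k" "branch N xs" for xs
  proof -
    \<comment> \<open>The head was chosen last: \<open>u\<close> completes \<open>a\<close>,
      \<open>b\<close> and \<open>us\<close> to an edge, then \<open>v\<close> completes
      \<open>A\<close>, and \<open>w\<close> completes the rest of the list.\<close>
    obtain w v u us where xs_eq: "xs = w # v # u # us" and us: "length us = k - 3"
      using xs(1) k3 by (cases xs; cases "tl xs"; cases "tl (tl xs)") auto
    have mem: "w \<in> N (v # u # us)" "v \<in> N (u # us)" "u \<in> N us" using xs(2) xs_eq by auto
    have u: "u \<in> nbh ({a, b} \<union> set us)" using mem(3) us by (simp add: N_def C_def)
    have lengths: "length (u # us) = k - 2" "length (v # u # us) = k - 1" using us k3 by auto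
    have neqs: "k - 2 \<noteq> k - 3" "k - 1 \<noteq> k - 3" "k - 1 \<noteq> k - 2" using k3 by linarith+
    have v: "v \<in> nbh A"
      using mem(2) neqs(1) unfolding N_def C_def lengths by (simp del: set_simps)
    have w: "w \<in> nbh (set (v # u # us))"
      using mem(1) neqs(2,3) unfolding N_def C_def lengths by (simp del: set_simps)
    have e: "set xs \<in> E" using w by (simp add: nbh_def xs_eq)
    have e1: "insert v A \<in> E" using v by (simp add: nbh_def)
    have e2: "insert u ({a, b} \<union> set us) \<in> E" using u by (simp add: nbh_def)
    have S_xs: "distinct xs" "set xs \<inter> S = {}" using br[OF xs(2)] by auto
    have aS: "a \<in> S" "b \<in> S" "a \<notin> A" "b \<notin> A" using ab by auto
    have "insert v A \<inter> insert u ({a, b} \<union> set us) = {}"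
      using S_xs aS A(1) by (auto simp: xs_eq)
    moreover have "insert v A \<union> insert u ({a, b} \<union> set us) \<subseteq> S \<union> set xs"
      using aS A(1) by (auto simp: xs_eq)
    ultimately show ?thesis unfolding absorbs_def using e e1 e2 S_xs(2) by blast
  qed
  then have sub: "{xs. length xs = k \<and> branch N xs} \<subseteq>
    {xs. length xs = k \<and> set xs \<subseteq> V \<and> set xs \<inter> W = {} \<and> absorbs S (set xs)}"
    using br by blast
  have "finite {xs. length xs = k \<and> set xs \<subseteq> V \<and> set xs \<inter> W = {} \<and> absorbs S (set xs)}"
    by (rule finite_subset[OF _ finite_lists_length_eq[OF finite_V, of k]]) auto
  with sub have "card {xs. length xs = k \<and> branch N xs} \<le>
    card {xs. length xs = k \<and> set xs \<subseteq> V \<and> set xs \<inter> W = {} \<and> absorbs S (set xs)}"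
    by (rule card_mono[rotated])
  moreover have "m ^ k \<le> card {xs. length xs = k \<and> branch N xs}"
    using card_branch_ge[of k N m] N_ge by blast
  ultimately show ?thesis by linarith
qed

text \<open>By double counting, some edge absorbs a \<open>c\<close>-fraction of the sets not yet absorbed; this
  replaces the usual random choice of the absorbing matching.\<close>

lemma greedy_absorbing_matching:
  fixes c w :: real
  assumes c: "0 < c" and V: "V \<noteq> {}"
    and many: "\<And>S W. S \<in> nsets V (k + 1) \<Longrightarrow> W \<subseteq> V \<Longrightarrow> real (card W) \<le> w \<Longrightarrow>
      c * real (card V) ^ k \<le>
      real (card {xs. length xs = k \<and> set xs \<subseteq> V \<and> set xs \<inter> W = {} \<and> absorbs S (set xs)})"
    and W: "W \<subseteq> V" "real (card W + k * l) \<le> w"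
  shows "\<exists>M. matching E M \<and> \<Union>M \<inter> W = {} \<and> card M \<le> l \<and>
    real (card {S \<in> nsets V (k + 1). \<forall>e\<in>M. \<not> absorbs S e}) \<le>
      (1 - c) ^ l * real (card (nsets V (k + 1)))"
  using W(2)
proof (induction l)
  case 0
  show ?case by (intro exI[of _ "{}"]) (simp add: matching_def)
next
  case (Suc l)
  have finS: "finite (nsets V (k + 1))" by (rule finite_imp_finite_nsets[OF finite_V])
  have "real (card W + k * l) \<le> w" using Suc.prems by (simp add: algebra_simps)
  from Suc.IH[OF this] obtain M where M: "matching E M" "\<Union>M \<inter> W = {}" "card M \<le> l"
    "real (card {S \<in> nsets V (k + 1). \<forall>e\<in>M. \<not> absorbs S e}) \<le>
      (1 - c) ^ l * real (card (nsets V (k + 1)))" by blast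
  define F where "F = {S \<in> nsets V (k + 1). \<forall>e\<in>M. \<not> absorbs S e}"
  have finF: "finite F" using finS by (simp add: F_def)
  show ?case
  proof (cases "F = {}")
    case True
    \<comment> \<open>No set is left to absorb, so \<open>M\<close> is kept and the bound only has
      to be nonnegative. If some \<open>S\<close> exists, this follows from
      \<open>c \<le> 1\<close>, which holds since at most all \<open>card V ^ k\<close> lists absorb
      \<open>S\<close>; otherwise the bound is 0.\<close>
    have "c * real (card V) ^ k \<le> real (card V) ^ k" if "nsets V (k + 1) \<noteq> {}"
    proof -
      have "0 \<le> w" using Suc.prems by linarith
      obtain S where S: "S \<in> nsets V (k + 1)" using \<open>nsets V (k + 1) \<noteq> {}\<close> by blast
      from many[OF S, of "{}"] \<open>0 \<le> w\<close> have "c * real (card V) ^ k \<le>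
        real (card {xs. length xs = k \<and> set xs \<subseteq> V \<and> absorbs S (set xs)})" by simp
      also have "\<dots> \<le> real (card {xs. set xs \<subseteq> V \<and> length xs = k})"
        using finite_lists_length_eq[OF finite_V, of k]
        by (intro of_nat_mono card_mono) auto
      finally show ?thesis by (simp add: card_lists_length_eq[OF finite_V])
    qed
    then have "nsets V (k + 1) \<noteq> {} \<Longrightarrow> c \<le> 1"
      using V finite_V by (simp add: card_gt_0_iff)
    then have "0 \<le> (1 - c) ^ Suc l * real (card (nsets V (k + 1)))"
      by (cases "nsets V (k + 1) = {}") simp_all
    moreover have "real (card {S \<in> nsets V (k + 1). \<forall>e\<in>M. \<not> absorbs S e}) = 0"
      by (simp only: True[unfolded F_def] card.empty of_nat_0)
    moreover have "card M \<le> Suc l" using M(3) by simp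
    ultimately show ?thesis using M(1,2) by (intro exI[of _ M]) simp_all
  next
    case False
    define W' where "W' = W \<union> \<Union>M"
    define L where "L = {xs. set xs \<subseteq> V \<and> length xs = k}"
    define good where "good S xs \<longleftrightarrow> set xs \<inter> W' = {} \<and> absorbs S (set xs)" for S xs
    have finL: "finite L" and cL: "card L = card V ^ k"
      unfolding L_def using finite_lists_length_eq[OF finite_V] card_lists_length_eq[OF finite_V] by auto
    have "replicate k v \<in> L" if "v \<in> V" for v using that by (auto simp: L_def)
    then have L_ne: "L \<noteq> {}" using V by blast
    have W': "W' \<subseteq> V" using W(1) matchingD(3)[OF M(1)] by (simp add: W'_def)
    have "card W' \<le> card W + k * card M"
      unfolding W'_def using card_Un_le[of W "\<Union>M"] matchingD(5)[OF M(1)] by simp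
    also have "\<dots> \<le> card W + k * l" using M(3) by simp
    also have "\<dots> \<le> card W + k * Suc l" by simp
    finally have "card W' \<le> card W + k * Suc l" .
    then have cW': "real (card W') \<le> w" using Suc.prems by linarith
    have goodL: "{xs. length xs = k \<and> set xs \<subseteq> V \<and> set xs \<inter> W' = {} \<and> absorbs S (set xs)} =
      {xs \<in> L. good S xs}" for S
      by (auto simp: L_def good_def)
    \<comment> \<open>Averaging over the lists: at least a \<open>c\<close>-fraction of them is good
      for each \<open>S\<close> in \<open>F\<close>, so some list is good for at least a
      \<open>c\<close>-fraction of \<open>F\<close>.\<close>
    have "\<exists>xs\<in>L. c * real (card F) \<le> real (card {S \<in> F. good S xs})"
    proof (rule ccontr)
      assume "\<not> ?thesis"
      then have "(\<Sum>xs\<in>L. real (card {S \<in> F. good S xs})) < (\<Sum>xs\<in>L. c * real (card F))"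
        using L_ne finL by (intro sum_strict_mono) auto
      moreover have "(\<Sum>xs\<in>L. card {S \<in> F. good S xs}) = (\<Sum>S\<in>F. card {xs \<in> L. good S xs})"
        using sum_multicount_gen[OF finL finF, of "\<lambda>xs S. good S xs" "\<lambda>S. card {xs \<in> L. good S xs}"]
        by simp
      then have "(\<Sum>xs\<in>L. real (card {S \<in> F. good S xs})) = (\<Sum>S\<in>F. real (card {xs \<in> L. good S xs}))"
        by (simp only: of_nat_sum[symmetric])
      moreover have "(\<Sum>S\<in>F. c * real (card V) ^ k) \<le> (\<Sum>S\<in>F. real (card {xs \<in> L. good S xs}))"
        using many[OF _ W' cW', unfolded goodL] by (intro sum_mono) (auto simp: F_def)
      ultimately show False by (simp add: cL mult.commute mult.left_commute)
    qed
    then obtain xs where xs: "xs \<in> L" "c * real (card F) \<le> real (card {S \<in> F. good S xs})"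
      by blast
    \<comment> \<open>As \<open>F\<close> is nonempty, the list is good for at least one
      \<open>S\<close>; this is what makes \<open>set xs\<close> an edge outside
      \<open>W'\<close>.\<close>
    have "0 < c * real (card F)" using c False finF by (simp add: card_gt_0_iff)
    then have "0 < card {S \<in> F. good S xs}" using xs(2) by linarith
    then have "{S \<in> F. good S xs} \<noteq> {}" by (auto simp only: card.empty)
    then have e: "set xs \<in> E" "set xs \<inter> W' = {}" by (auto simp: good_def absorbs_def)
    have m: "matching E {set xs}" using e(1) by (simp add: matching_def)
    have d: "\<Union>M \<inter> \<Union>{set xs} = {}" using e(2) by (auto simp: W'_def)
    have "{S \<in> nsets V (k + 1). \<forall>e\<in>M \<union> {set xs}. \<not> absorbs S e} = F - {S \<in> F. good S xs}"
      using e(2) by (auto simp: F_def good_def)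
    then have "real (card {S \<in> nsets V (k + 1). \<forall>e\<in>M \<union> {set xs}. \<not> absorbs S e}) =
      real (card F) - real (card {S \<in> F. good S xs})"
      using finF by (simp add: card_Diff_subset card_mono)
    also have "\<dots> \<le> (1 - c) * real (card F)" using xs(2) by (simp add: algebra_simps)
    also have "\<dots> \<le> (1 - c) * ((1 - c) ^ l * real (card (nsets V (k + 1))))"
    proof (rule mult_left_mono)
      show "real (card F) \<le> (1 - c) ^ l * real (card (nsets V (k + 1)))"
        using M(4) by (simp add: F_def)
      have "c * real (card F) \<le> 1 * real (card F)"
        using xs(2) card_mono[OF finF, of "{S \<in> F. good S xs}"] by auto
      then show "0 \<le> 1 - c" using False finF by (simp add: card_gt_0_iff)
    qed
    finally have "real (card {S \<in> nsets V (k + 1). \<forall>e\<in>M \<union> {set xs}. \<not> absorbs S e}) \<le>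
      (1 - c) ^ Suc l * real (card (nsets V (k + 1)))" by simp
    moreover have "\<Union>(M \<union> {set xs}) \<inter> W = {}" using M(2) e(2) by (auto simp: W'_def)
    moreover have "card (M \<union> {set xs}) \<le> Suc l"
      using card_matching_Un[OF M(1) m d] M(3) by simp
    ultimately show ?thesis using matching_Un[OF M(1) m d] by blast
  qed
qed

text \<open>Each of \<open>r\<close> rounds applies the greedy construction outside the edges found
  so far. By \<open>l\<close> fewer than one, hence no, set remains without an absorber in a round,
  so every round adds a new absorber for every \<open>S\<close>.\<close>

lemma ex_absorbing_matching:
  fixes c w :: real
  assumes c: "0 < c" and V: "V \<noteq> {}"
    and many: "\<And>S W. S \<in> nsets V (k + 1) \<Longrightarrow> W \<subseteq> V \<Longrightarrow> real (card W) \<le> w \<Longrightarrow>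
      c * real (card V) ^ k \<le>
      real (card {xs. length xs = k \<and> set xs \<subseteq> V \<and> set xs \<inter> W = {} \<and> absorbs S (set xs)})"
    and l: "(1 - c) ^ l * real (card (nsets V (k + 1))) < 1"
    and w: "real (k * (r * l)) \<le> w"
  shows "\<exists>M. matching E M \<and> card M \<le> r * l \<and>
    (\<forall>S\<in>nsets V (k + 1). r \<le> card {e \<in> M. absorbs S e})"
  using w
proof (induction r)
  case 0
  show ?case by (intro exI[of _ "{}"]) (simp add: matching_def)
next
  case (Suc r)
  have "k * (r * l) \<le> k * (Suc r * l)" by (intro mult_le_mono) simp_all
  then have "real (k * (r * l)) \<le> w" using Suc.prems by linarith
  from Suc.IH[OF this] obtain M where M: "matching E M" "card M \<le> r * l"
    "\<And>S. S \<in> nsets V (k + 1) \<Longrightarrow> r \<le> card {e \<in> M. absorbs S e}" by blast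
  have "card (\<Union>M) + k * l \<le> k * (Suc r * l)"
    using M(2) matchingD(5)[OF M(1)] mult_le_mono2[OF M(2), of k] by (simp add: algebra_simps)
  then have "real (card (\<Union>M) + k * l) \<le> w" using Suc.prems by linarith
  from greedy_absorbing_matching[OF c V many matchingD(3)[OF M(1)] this]
  obtain M1 where M1: "matching E M1" "\<Union>M1 \<inter> \<Union>M = {}" "card M1 \<le> l"
    "real (card {S \<in> nsets V (k + 1). \<forall>e\<in>M1. \<not> absorbs S e}) \<le>
      (1 - c) ^ l * real (card (nsets V (k + 1)))" by blast
  have d: "\<Union>M \<inter> \<Union>M1 = {}" using M1(2) by blast
  have "card {S \<in> nsets V (k + 1). \<forall>e\<in>M1. \<not> absorbs S e} = 0" using M1(4) l by linarith
  then have all: "\<exists>e\<in>M1. absorbs S e" if "S \<in> nsets V (k + 1)" for S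
    using that finite_imp_finite_nsets[OF finite_V, of "k + 1"] by auto
  have "Suc r \<le> card {e \<in> M \<union> M1. absorbs S e}" if S: "S \<in> nsets V (k + 1)" for S
  proof -
    obtain e where e: "e \<in> M1" "absorbs S e" using all[OF S] by blast
    have "e \<notin> M" using e(1) d edge_nonempty matchingD(1)[OF M1(1)] by blast
    then have "Suc (card {e \<in> M. absorbs S e}) = card (insert e {e \<in> M. absorbs S e})"
      using matchingD(2)[OF M(1)] by simp
    also have "\<dots> \<le> card {e \<in> M \<union> M1. absorbs S e}"
      using e matchingD(2)[OF M(1)] matchingD(2)[OF M1(1)] by (intro card_mono) auto
    finally show ?thesis using M(3)[OF S] by linarith
  qed
  moreover have "card (M \<union> M1) \<le> Suc r * l"
    using card_matching_Un[OF M(1) M1(1) d] M(2) M1(3) by simp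
  ultimately show ?case using matching_Un[OF M(1) M1(1) d] by blast
qed

text \<open>While more than \<open>k\<close> vertices are left, \<open>k + 1\<close> of them form a
  set \<open>S\<close>, and an absorber \<open>e\<close> of \<open>S\<close> in \<open>M\<close> is
  exchanged for two edges added to \<open>Q\<close>. The supply lasts: an exchange costs each set at
  most one absorber, while the leftover drops by at least one.\<close>

lemma absorb_leftover:
  assumes "matching E Q" "matching E M" "\<Union>Q \<inter> \<Union>M = {}"
    and "\<And>S. S \<in> nsets V (k + 1) \<Longrightarrow> card (V - \<Union>Q - \<Union>M) \<le> card {e \<in> M. absorbs S e}"
  shows "\<exists>Q'. matching E Q' \<and> card (V - \<Union>Q') \<le> k"
  using assms
proof (induction "card (V - \<Union>Q - \<Union>M)" arbitrary: Q M rule: less_induct)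
  case less
  define U where "U = V - \<Union>Q - \<Union>M"
  have finU: "finite U" using finite_V by (simp add: U_def)
  show ?case
  proof (cases "card U \<le> k")
    case True
    have "V - \<Union>(Q \<union> M) = U" by (auto simp: U_def)
    then show ?thesis using matching_Un[OF less.prems(1-3)] True by metis
  next
    case False
    then have "k + 1 \<le> card U" by simp
    then obtain S where S: "S \<subseteq> U" "card S = k + 1" "finite S"
      using obtain_subset_with_card_n by metis
    then have SV: "S \<in> nsets V (k + 1)" by (auto simp: nsets_def U_def)
    have "card {e \<in> M. absorbs S e} \<noteq> 0" using less.prems(4)[OF SV] False by (simp add: U_def)
    then have "{e \<in> M. absorbs S e} \<noteq> {}" by (metis card.empty)
    then obtain e where e: "e \<in> M" "absorbs S e" by blast
    then obtain e1 e2 where ee: "e1 \<in> E" "e2 \<in> E" "e1 \<inter> e2 = {}" "e1 \<union> e2 \<subseteq> S \<union> e"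
      by (auto simp: absorbs_def)
    have eE: "e \<in> E" using e(2) by (simp add: absorbs_def)
    define Q' where "Q' = Q \<union> {e1, e2}"
    define M' where "M' = M - {e}"
    have UQM: "U \<inter> \<Union>Q = {}" "U \<inter> \<Union>M = {}" by (auto simp: U_def)
    have m12: "matching E {e1, e2}" using ee by (auto simp: matching_def pairwise_def disjnt_def)
    have dQ: "\<Union>Q \<inter> \<Union>{e1, e2} = {}"
    proof -
      have "\<Union>Q \<inter> (S \<union> e) = {}" using e(1) less.prems(3) S(1) UQM by blast
      then show ?thesis using ee(4) by auto
    qed
    have mQ': "matching E Q'" unfolding Q'_def by (rule matching_Un[OF less.prems(1) m12 dQ])
    have mM': "matching E M'" unfolding M'_def by (rule matching_subset[OF less.prems(2)]) auto
    have eM': "e \<inter> \<Union>M' = {}"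
      using matching_Union_Diff[OF less.prems(2), of "{e}"] e(1) by (auto simp: M'_def)
    have dQM: "\<Union>Q' \<inter> \<Union>M' = {}"
    proof -
      have "(S \<union> e) \<inter> \<Union>M' = {}" using eM' S(1) UQM by (auto simp: M'_def)
      then have "(e1 \<union> e2) \<inter> \<Union>M' = {}" using ee(4) by blast
      moreover have "\<Union>Q \<inter> \<Union>M' = {}" using less.prems(3) by (auto simp: M'_def)
      ultimately show ?thesis by (auto simp: Q'_def)
    qed
    have "V - \<Union>Q' - \<Union>M' \<subseteq> (U \<union> e) - (e1 \<union> e2)"
      by (auto simp: U_def Q'_def M'_def)
    then have "card (V - \<Union>Q' - \<Union>M') \<le> card ((U \<union> e) - (e1 \<union> e2))"
      using finU edgeD(2)[OF eE] by (intro card_mono) auto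
    also have "\<dots> = card (U \<union> e) - card (e1 \<union> e2)"
      using ee(4) S(1) edgeD(2)[OF ee(1)] edgeD(2)[OF ee(2)] by (intro card_Diff_subset) auto
    also have "card (e1 \<union> e2) = 2 * k"
      using ee(3) edgeD[OF ee(1)] edgeD[OF ee(2)] by (simp add: card_Un_disjoint)
    also have "card (U \<union> e) - 2 * k \<le> card U - 1"
      using card_Un_le[of U e] edgeD(3)[OF eE] k_ge_2 by simp
    finally have le: "card (V - \<Union>Q' - \<Union>M') \<le> card U - 1" .
    have lt: "card (V - \<Union>Q' - \<Union>M') < card (V - \<Union>Q - \<Union>M)"
      using le False by (simp add: U_def)
    show ?thesis
    proof (rule less.hyps[OF lt mQ' mM' dQM])
      fix S' assume "S' \<in> nsets V (k + 1)"
      then have "card U \<le> card {e \<in> M. absorbs S' e}" using less.prems(4) by (simp add: U_def)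
      moreover have "card {e \<in> M. absorbs S' e} - 1 \<le> card {e \<in> M'. absorbs S' e}"
      proof -
        have "{e' \<in> M'. absorbs S' e'} = {e' \<in> M. absorbs S' e'} - {e}" by (auto simp: M'_def)
        then show ?thesis
          using matchingD(2)[OF less.prems(2)] diff_card_le_card_Diff[of "{e}" "{e' \<in> M. absorbs S' e'}"]
          by simp
      qed
      ultimately show "card (V - \<Union>Q' - \<Union>M') \<le> card {e \<in> M'. absorbs S' e}" using le by linarith
    qed
  qed
qed

text \<open>The number of uncovered vertices is congruent to \<open>card V\<close> modulo
  \<open>k\<close>. It is at most \<open>k\<close>, and non-divisibility excludes \<open>k\<close>
  itself, so fewer than \<open>k\<close> vertices are uncovered.\<close>

lemma near_perfect_card:
  assumes "matching E Q" "card (V - \<Union>Q) \<le> k" "\<not> k dvd card V"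
  shows "card Q = card V div k"
proof -
  have "card (V - \<Union>Q) = card V - k * card Q" "k * card Q \<le> card V"
    using matchingD(3-5)[OF assms(1)] card_mono[OF finite_V matchingD(3)[OF assms(1)]]
    by (simp_all add: card_Diff_subset)
  then have le: "k * card Q \<le> card V" "card V \<le> k * card Q + k" using assms(2) by auto
  moreover have "card V \<noteq> k * card Q + k" using assms(3) by (metis dvd_add dvd_triv_left dvd_refl)
  ultimately have "card V < k * card Q + k" by simp
  then show ?thesis using le(1) by (intro div_nat_eqI[symmetric]) (auto simp: mult.commute)
qed

end

section \<open>The non-extremal case\<close>

text \<open>With \<open>l\<close> the integer part of \<open>a * n / m\<close>, the bound
  \<open>1 - c \<le> exp (- c)\<close> makes \<open>(1 - c) ^ l\<close> exponentially small in
  \<open>n\<close>, which beats the polynomial factor.\<close>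

lemma eventually_ex_rounds:
  fixes a c :: real
  assumes "0 < a" "0 < c" "c \<le> 1" "0 < m"
  shows "\<exists>n0. \<forall>n\<ge>n0. \<exists>l. real (m * l) \<le> a * real n \<and> (1 - c) ^ l * real n ^ p < 1"
proof -
  have m: "0 < real m" using assms(4) by simp
  define b where "b = a / m"
  have b: "0 < b" using assms(1) m by (simp add: b_def)
  have "((\<lambda>n. exp (- c * (b * real n - 1)) * real n ^ p) \<longlonglongrightarrow> 0)"
    using assms(2) b by real_asymp
  then have "\<forall>\<^sub>F n in sequentially. exp (- c * (b * real n - 1)) * real n ^ p < 1"
    by (rule order_tendstoD) simp
  then obtain n0 where n0: "\<And>n. n \<ge> n0 \<Longrightarrow> exp (- c * (b * real n - 1)) * real n ^ p < 1"
    by (auto simp: eventually_sequentially)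
  have "\<exists>l. real (m * l) \<le> a * real n \<and> (1 - c) ^ l * real n ^ p < 1" if "n \<ge> n0" for n
  proof -
    define l where "l = nat \<lfloor>b * real n\<rfloor>"
    have "0 \<le> b * real n" using b by simp
    then have l: "real l \<le> b * real n" "b * real n - 1 \<le> real l"
      unfolding l_def by linarith+
    have "real m * real l \<le> real m * (b * real n)" using l(1) m by (intro mult_left_mono) auto
    also have "\<dots> = a * real n" using m by (simp add: b_def)
    finally have "real (m * l) \<le> a * real n" by simp
    have "(1 - c) ^ l \<le> exp (- c) ^ l"
      using exp_ge_add_one_self[of "- c"] assms(3) by (intro power_mono) auto
    also have "exp (- c) ^ l = exp (- c * real l)"
      by (simp add: exp_of_nat_mult[symmetric] mult.commute)
    also have "\<dots> \<le> exp (- c * (b * real n - 1))"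
      using l(2) assms(2) by simp
    finally have "(1 - c) ^ l * real n ^ p \<le> exp (- c * (b * real n - 1)) * real n ^ p"
      by (rule mult_right_mono) simp
    with n0[OF that] \<open>real (m * l) \<le> a * real n\<close> show ?thesis by (intro exI[of _ l]) auto
  qed
  then show ?thesis by blast
qed

theorem theorem1p4:
  fixes k :: nat and \<gamma> :: real
  assumes "k \<ge> 3" and "\<gamma> > 0"
  shows "\<exists>n\<^sub>0::nat. \<forall>n\<ge>n\<^sub>0. \<not> k dvd n \<longrightarrow>
    (\<forall>(V :: 'a set) (E :: 'a set set).
      uniform_hypergraph k V E \<and> card V = n \<and>
      real (min_degree (k - 1) V E) \<ge> real n / real k - \<gamma> * real n \<and>
      \<not> extremal (5 * real k * \<gamma>) k V E
      \<longrightarrow> (\<exists>M. matching E M \<and> card M = n div k))"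
proof (cases "1 \<le> 5 * real k * \<gamma>")
  case True
  \<comment> \<open>A required size of at most 0 is met by the empty set, which is independent
    because edges are nonempty.\<close>
  have "extremal (5 * real k * \<gamma>) k V E" if "uniform_hypergraph k V E" for V :: "'a set" and E
  proof -
    interpret kgraph k V E using assms(1) that by unfold_locales auto
    have "(1 - 5 * real k * \<gamma>) * ((real k - 1) / real k) * real (card V) \<le> 0"
      using True assms(1) by (intro mult_nonpos_nonneg) auto
    moreover have "independent_vertices V E {}"
      using edge_nonempty by (auto simp: independent_vertices_def)
    ultimately show ?thesis unfolding extremal_def by (intro exI[of _ "{}"]) simp
  qed
  then show ?thesis by blast
next
  case False
  have k0: "0 < real k" using assms(1) by simp
  \<comment> \<open>This makes \<open>k \<le> \<gamma> * t\<close>, so that the error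
    \<open>k * card V\<close> of the double count costs at most \<open>\<gamma> * n\<close> for each
    of the \<open>t\<close> sets.\<close>
  define t where "t = nat \<lceil>real k / \<gamma>\<rceil>"
  have t: "real k / \<gamma> \<le> real t" unfolding t_def by linarith
  have t0: "0 < real t" using t k0 assms(2) by (smt (verit) divide_pos_pos)
  have kt: "real k \<le> \<gamma> * real t" using t assms(2) by (simp add: field_simps)
  \<comment> \<open>Any \<open>r\<close> uncovered vertices can be split into \<open>t\<close> sets
    of size \<open>k - 1\<close>; \<open>r\<close> does not depend on \<open>n\<close>.\<close>
  define r where "r = t * (k - 1)"
  \<comment> \<open>Each of the \<open>k\<close> entries of an absorbing list will have at least
    \<open>n / (5 * k)\<close> choices out of \<open>n\<close>.\<close>
  define c where "c = (1 / (5 * real k)) ^ k"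
  have c: "0 < c" "c \<le> 1" using assms(1) by (auto simp: c_def intro!: power_le_one)
  have "0 < k * r" using t0 assms(1) by (simp add: r_def)
  from eventually_ex_rounds[OF assms(2) c this, of "k + 1"] obtain n1 where
    n1: "\<And>n. n \<ge> n1 \<Longrightarrow> \<exists>l. real (k * r * l) \<le> \<gamma> * real n \<and> (1 - c) ^ l * real n ^ (k + 1) < 1"
    by blast
  have "\<exists>M. matching E M \<and> card M = card V div k"
    if large: "max n1 (5 * k * (k + 1)) \<le> card V" and ndvd: "\<not> k dvd card V"
      and unif: "uniform_hypergraph k V E"
      and mindeg: "real (card V) / real k - \<gamma> * real (card V) \<le> real (min_degree (k - 1) V E)"
      and nonext: "\<not> extremal (5 * real k * \<gamma>) k V E"
    for V :: "'a set" and E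
  proof -
    interpret kgraph k V E using assms(1) unif by unfold_locales auto
    define n where "n = card V"
    have V: "V \<noteq> {}" using ndvd by auto
    \<comment> \<open>In units of \<open>q\<close>, the codegrees are at least
      \<open>5 * q - q\<close>, because \<open>5 * k * \<gamma> < 1\<close>; the bound
      \<open>n \<ge> 5 * k * (k + 1)\<close> gives \<open>q \<ge> k + 1\<close>.\<close>
    define q where "q = real n / (5 * real k)"
    have nk: "real n / real k = 5 * q" using k0 by (simp add: q_def)
    have "real (5 * k * (k + 1)) \<le> real n" using large unfolding n_def by linarith
    then have q: "real k + 1 \<le> q" using k0 by (simp add: q_def field_simps)
    have "\<gamma> * real n \<le> 1 / (5 * real k) * real n"
      using False k0 by (intro mult_right_mono) (auto simp: field_simps)
    then have \<gamma>n: "\<gamma> * real n \<le> q" by (simp add: q_def)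
    have deg: "real n / real k - \<gamma> * real n \<le> real (card (nbh A))" if "A \<in> nsets V (k - 1)" for A
      using mindeg min_degree_le_card_nbh[OF that] unfolding n_def by linarith
    have many: "c * real (card V) ^ k \<le>
      real (card {xs. length xs = k \<and> set xs \<subseteq> V \<and> set xs \<inter> W = {} \<and> absorbs S (set xs)})"
      if "S \<in> nsets V (k + 1)" "W \<subseteq> V" "real (card W) \<le> \<gamma> * real n" for S W
    proof -
      define m where "m = nat \<lceil>q\<rceil>"
      have m: "q \<le> real m" "real m \<le> q + 1" using q unfolding m_def by linarith+
      \<comment> \<open>The left-hand side is at most
        \<open>(q + 1) + q + (2 * k + 1) \<le> 4 * q\<close>, which the codegrees reach.\<close>
      have "m + card W + (2 * k + 1) \<le> card (nbh A)" if A: "A \<in> nsets V (k - 1)" for A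
      proof -
        have "real (m + card W + (2 * k + 1)) \<le> real (card (nbh A))"
          using deg[OF A] m(2) q \<gamma>n nk \<open>real (card W) \<le> \<gamma> * real n\<close> by simp
        then show ?thesis by linarith
      qed
      from card_absorbing_lists_ge[OF assms(1) that(1,2) this]
      have "real m ^ k \<le>
        real (card {xs. length xs = k \<and> set xs \<subseteq> V \<and> set xs \<inter> W = {} \<and> absorbs S (set xs)})"
        by (simp only: of_nat_le_iff of_nat_power[symmetric])
      moreover have "c * real (card V) ^ k = q ^ k"
        by (simp add: c_def q_def n_def power_divide)
      moreover have "q ^ k \<le> real m ^ k" using m q by (intro power_mono) auto
      ultimately show ?thesis by linarith
    qed
    obtain l where l: "real (k * r * l) \<le> \<gamma> * real n" "(1 - c) ^ l * real n ^ (k + 1) < 1"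
      using n1[of n] large by (auto simp: n_def)
    have "k + 1 \<le> 5 * k * (k + 1)" using assms(1) by simp
    then have "k + 1 \<le> n" using large unfolding n_def by linarith
    then have "real (card (nsets V (k + 1))) \<le> real n ^ (k + 1)"
      using binomial_le_pow[of "k + 1" n] by (simp add: n_def flip: of_nat_power del: power_Suc)
    then have "(1 - c) ^ l * real (card (nsets V (k + 1))) \<le> (1 - c) ^ l * real n ^ (k + 1)"
      using c by (intro mult_left_mono) auto
    with l(2) have l2: "(1 - c) ^ l * real (card (nsets V (k + 1))) < 1" by linarith
    have l1: "real (k * (r * l)) \<le> \<gamma> * real n" using l(1) by (simp add: mult.assoc)
    from ex_absorbing_matching[OF c(1) V many l2 l1] obtain Ma where
      Ma: "matching E Ma" "card Ma \<le> r * l"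
      "\<And>S. S \<in> nsets V (k + 1) \<Longrightarrow> r \<le> card {e \<in> Ma. absorbs S e}" by blast
    define W where "W = \<Union>Ma"
    have W: "W \<subseteq> V" "card W \<le> k * (r * l)" using matchingD[OF Ma(1)] Ma(2) by (auto simp: W_def)
    obtain M where M: "matching E M" "\<Union>M \<inter> W = {}"
      and max: "\<And>M'. matching E M' \<Longrightarrow> \<Union>M' \<inter> W = {} \<Longrightarrow> card M' \<le> card M"
      using ex_maximum_matching[of W] by blast
    have "card (V - W - \<Union>M) < r"
    proof (rule ccontr)
      assume "\<not> card (V - W - \<Union>M) < r"
      then have r: "t * (k - 1) \<le> card (V - W - \<Union>M)" by (simp add: r_def)
      define d where "d = nat \<lceil>real n / real k - \<gamma> * real n\<rceil>"
      have d: "real n / real k - \<gamma> * real n \<le> real d" unfolding d_def by linarith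
      have "d \<le> card (nbh A)" if "A \<in> nsets V (k - 1)" for A
        using deg[OF that] unfolding d_def by linarith
      from maximum_matching_independent[OF W(1) M max this r] obtain T where
        T: "independent_vertices V E T"
        "(k - 1) * (t * d) \<le> t * card T + (k - 1) * (t * card W + k * card V)" by blast
      have k1: "real (k - 1) = real k - 1" using assms(1) by simp
      \<comment> \<open>Since \<open>W\<close> and the error term each cost at most
        \<open>\<gamma> * n\<close>, \<open>T\<close> has at least
        \<open>(k - 1) * (d - 2 * \<gamma> * n)\<close> vertices. As \<open>d\<close> is at least
        \<open>n / k - \<gamma> * n\<close>, the total loss is at most
        \<open>3 * \<gamma> * n\<close>, within the allowed \<open>5 * \<gamma> * n\<close>.\<close>
      have "real ((k - 1) * (t * d)) \<le> real (t * card T + (k - 1) * (t * card W + k * card V))"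
        using T(2) by (rule of_nat_mono)
      then have "(real k - 1) * (real t * real d) \<le>
        real t * real (card T) + (real k - 1) * (real t * real (card W) + real k * real n)"
        unfolding n_def by (simp only: of_nat_add of_nat_mult k1)
      also have "\<dots> \<le> real t * real (card T) +
          (real k - 1) * (real t * (\<gamma> * real n) + (\<gamma> * real t) * real n)"
      proof -
        have "real (card W) \<le> \<gamma> * real n" using W(2) l1 by linarith
        then have "real t * real (card W) + real k * real n \<le>
          real t * (\<gamma> * real n) + (\<gamma> * real t) * real n"
          using kt by (intro add_mono mult_left_mono mult_right_mono) auto
        then show ?thesis using assms(1) by (intro add_left_mono mult_left_mono) auto
      qed
      finally have "real t * ((real k - 1) * (real d - 2 * \<gamma> * real n)) \<le> real t * real (card T)"
        by (simp add: algebra_simps)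
      then have "(real k - 1) * (real d - 2 * \<gamma> * real n) \<le> real (card T)" using t0 by simp
      moreover have "(1 - 5 * real k * \<gamma>) * ((real k - 1) / real k) * real n =
        (real k - 1) * (real n / real k - 5 * \<gamma> * real n)"
        using k0 by (simp add: field_simps)
      moreover have "(real k - 1) * (real n / real k - 5 * \<gamma> * real n) \<le>
        (real k - 1) * (real d - 2 * \<gamma> * real n)"
      proof (rule mult_left_mono)
        have "0 \<le> \<gamma> * real n" using assms(2) by simp
        then show "real n / real k - 5 * \<gamma> * real n \<le> real d - 2 * \<gamma> * real n" using d by linarith
      qed (use assms(1) in simp)
      ultimately have "extremal (5 * real k * \<gamma>) k V E"
        unfolding extremal_def using T(1) by (intro exI[of _ T]) (simp add: n_def)
      with nonext show False ..
    qed
    \<comment> \<open>Fewer than \<open>r\<close> vertices are left and each \<open>S\<close> has at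
      least \<open>r\<close> absorbers in \<open>Ma\<close>, so the supply suffices.\<close>
    then have "card (V - \<Union>M - \<Union>Ma) \<le> card {e \<in> Ma. absorbs S e}" if "S \<in> nsets V (k + 1)" for S
      using Ma(3)[OF that] by (simp add: W_def Diff_eq Int_ac)
    from absorb_leftover[OF M(1) Ma(1) M(2)[unfolded W_def] this]
    obtain Q where "matching E Q" "card (V - \<Union>Q) \<le> k" by blast
    then show ?thesis using near_perfect_card ndvd by blast
  qed
  then show ?thesis by (intro exI[of _ "max n1 (5 * k * (k + 1))"]) blast
qed

end
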